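(* Let $\Gamma = (\Gamma, \le, \mu, (\varphi_x)_{x \in V(\Gamma)})$ be a trickle graph. Then the trickle group $\mathrm{Tr}(\Gamma)$ is finite if and only if $V(\Gamma)$ is finite, $\Gamma$ is a complete graph, and $\mu(x)\neq\infty$ for all $x\in V(\Gamma)$.
   Context: **Trickle graphs.** For a simplicial graph $\Gamma$ (no loops or multiple edges, possibly infinite) with vertex set $V(\Gamma)$ and edge set $E(\Gamma)$, $\mathrm{star}_x(\Gamma)$ is the full subgraph spanned by $x$ and all vertices adjacent to $x$. A trickle graph is a quadruple $(\Gamma,\le,\mu,(\varphi_x)_{x\in V(\Gamma)})$ where $\Gamma$ is a simplicial graph, $\le$ is a partial order on $V(\Gamma)$, $\mu:V(\Gamma)\to\mathbb N_{\ge 2}\cup\{\infty\}$ is a labeling, and each $\varphi_x$ is a graph automorphism of $\mathrm{star}_x(\Gamma)$, such that, writing $x||y$ if $x\not\le y$ and $y\not\le x$, and $E_{||}(\Gamma)=\{\{x,y\}\in E(\Gamma)\mid x||y\}$: (a) if $x<y$ then $\{x,y\}\in E(\Gamma)$; (b) if $\{x,y\}\in E_{||}(\Gamma)$ and $z\le y$, then $\{x,z\}\in E_{||}(\Gamma)$; (c) for all $x$ and all $y,z\in \mathrm{star}_x(\Gamma)$: $z\le y$ iff $\varphi_x(z)\le\varphi_x(y)$; (d) for all $x$ and $y\in\mathrm{star}_x(\Gamma)$: if $\varphi_x(y)\ne y$ then $y<x$; (e) if $\mu(x)$ is finite, then $\varphi_x$ has finite order dividing $\mu(x)$; (f) $\mu(\varphi_x(y))=\mu(y)$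 for all $x$ and $y\in \mathrm{star}_x(\Gamma)$; (g) if $z<y<x$ then $(\varphi_x\circ\varphi_y)(z)=(\varphi_{y'}\circ\varphi_x)(z)$ where $y'=\varphi_x(y)$. The trickle group is $\mathrm{Tr}(\Gamma)=\langle V(\Gamma)\mid x^{\mu(x)}=1 \text{ if }\mu(x)\ne\infty,\ \varphi_x(y)\,x=\varphi_y(x)\,y\text{ for }\{x,y\}\in E(\Gamma)\rangle$. *)

theory Defs
  imports "HOL-Algebra.Bij" "HOL-Algebra.Multiplicative_Group" "HOL-Library.Extended_Nat"
begin

section \<open>Groups given by generators and relations\<close>

text \<open>
  A letter \<^term>\<open>(s, True)\<close> stands for the generator \<open>s\<close>, and \<^term>\<open>(s, False)\<close> for its formal
  inverse. A relation \<open>u = v\<close> is encoded as the pair \<^term>\<open>(u, v)\<close>.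
\<close>

type_synonym 'a gword = "('a \<times> bool) list"

definition gwords :: "'a set \<Rightarrow> 'a gword set" where
  "gwords S = lists (S \<times> UNIV)"

text \<open>
  The least congruence on the monoid of words that contains the relations and cancels inverse
  letters. Relations that are not between words over \<open>S\<close> are ignored.
\<close>

inductive pres_eq :: "'a set \<Rightarrow> ('a gword \<times> 'a gword) set \<Rightarrow> 'a gword \<Rightarrow> 'a gword \<Rightarrow> bool"
  for S R where
  relation: "(u, v) \<in> R \<Longrightarrow> u \<in> gwords S \<Longrightarrow> v \<in> gwords S \<Longrightarrow> pres_eq S R u v"
| cancel: "s \<in> S \<Longrightarrow> pres_eq S R [(s, b), (s, \<not> b)] []"
| refl: "u \<in> gwords S \<Longrightarrow> pres_eq S R u u"
| sym: "pres_eq S R u v \<Longrightarrow> pres_eq S R v u"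
| trans: "pres_eq S R u v \<Longrightarrow> pres_eq S R v w \<Longrightarrow> pres_eq S R u w"
| append: "pres_eq S R u v \<Longrightarrow> pres_eq S R u' v' \<Longrightarrow> pres_eq S R (u @ u') (v @ v')"

definition pres_rel :: "'a set \<Rightarrow> ('a gword \<times> 'a gword) set \<Rightarrow> 'a gword rel" where
  "pres_rel S R = {(u, v). pres_eq S R u v}"

definition presented_group ::
  "'a set \<Rightarrow> ('a gword \<times> 'a gword) set \<Rightarrow> 'a gword set monoid" where
  "presented_group S R =
    \<lparr>carrier = gwords S // pres_rel S R,
     monoid.mult = (\<lambda>A B. \<Union>u\<in>A. \<Union>v\<in>B. pres_rel S R `` {u @ v}),
     one = pres_rel S R `` {[]}\<rparr>"

lemma gwords_simps [simp]:
  "[] \<in> gwords S"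
  "(s, b) # u \<in> gwords S \<longleftrightarrow> s \<in> S \<and> u \<in> gwords S"
  "u @ v \<in> gwords S \<longleftrightarrow> u \<in> gwords S \<and> v \<in> gwords S"
  by (auto simp: gwords_def)

lemma pres_eq_gwords: "pres_eq S R u v \<Longrightarrow> u \<in> gwords S \<and> v \<in> gwords S"
  by (induction rule: pres_eq.induct) auto

lemma equiv_pres_rel: "equiv (gwords S) (pres_rel S R)"
  unfolding pres_rel_def
  by (rule equivI)
    (auto simp: refl_on_def sym_def trans_def dest: pres_eq_gwords
      intro: pres_eq.refl pres_eq.sym pres_eq.trans)

lemma pres_class_eq_iff:
  "u \<in> gwords S \<Longrightarrow> v \<in> gwords S \<Longrightarrow>
    pres_rel S R `` {u} = pres_rel S R `` {v} \<longleftrightarrow> pres_eq S R u v"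
  using eq_equiv_class_iff[OF equiv_pres_rel] by (fastforce simp: pres_rel_def)

lemma carrier_presented_group:
  "carrier (presented_group S R) = (\<lambda>u. pres_rel S R `` {u}) ` gwords S"
  by (auto simp: presented_group_def quotient_def)

lemma one_presented_group: "\<one>\<^bsub>presented_group S R\<^esub> = pres_rel S R `` {[]}"
  by (simp add: presented_group_def)

lemma mult_presented_group:
  assumes u: "u \<in> gwords S" and v: "v \<in> gwords S"
  shows "(pres_rel S R `` {u}) \<otimes>\<^bsub>presented_group S R\<^esub> (pres_rel S R `` {v})
    = pres_rel S R `` {u @ v}"
proof -
  have *: "pres_rel S R `` {u' @ v'} = pres_rel S R `` {u @ v}"
    if "u' \<in> pres_rel S R `` {u}" "v' \<in> pres_rel S R `` {v}" for u' v'
  proof -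
    have eq: "pres_eq S R u u'" "pres_eq S R v v'"
      using that by (simp_all add: pres_rel_def)
    then have "pres_eq S R (u' @ v') (u @ v)"
      by (blast intro: pres_eq.append[OF pres_eq.sym pres_eq.sym])
    with u v pres_eq_gwords[OF eq(1)] pres_eq_gwords[OF eq(2)] show ?thesis
      by (simp add: pres_class_eq_iff)
  qed
  have mem: "u \<in> pres_rel S R `` {u}" "v \<in> pres_rel S R `` {v}"
    using u v by (simp_all add: pres_rel_def pres_eq.refl)
  have "(\<Union>u'\<in>pres_rel S R `` {u}. \<Union>v'\<in>pres_rel S R `` {v}. pres_rel S R `` {u' @ v'})
    = (\<Union>u'\<in>pres_rel S R `` {u}. \<Union>v'\<in>pres_rel S R `` {v}. pres_rel S R `` {u @ v})"
    by (intro SUP_cong HOL.refl *)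
  also have "\<dots> = pres_rel S R `` {u @ v}"
    using mem by (simp only: UN_constant) (auto split: if_splits)
  finally show ?thesis by (simp only: presented_group_def monoid.simps)
qed

lemma pres_eq_inverse_word:
  "u \<in> gwords S \<Longrightarrow> \<exists>v\<in>gwords S. pres_eq S R (v @ u) []"
proof (induction u)
  case Nil
  then show ?case by (auto intro!: bexI[of _ "[]"] pres_eq.refl)
next
  case (Cons a u)
  obtain s b where a: "a = (s, b)" by force
  with Cons obtain v where v: "v \<in> gwords S" "pres_eq S R (v @ u) []" and s: "s \<in> S"
    and u: "u \<in> gwords S" by auto
  have "pres_eq S R (v @ [(s, \<not> b), (s, \<not> \<not> b)] @ u) (v @ [] @ u)"
    by (intro pres_eq.append pres_eq.refl pres_eq.cancel u v s)
  then have "pres_eq S R ((v @ [(s, \<not> b)]) @ a # u) []"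
    using v(2) by (auto simp: a intro: pres_eq.trans)
  then show ?case using v(1) s by (intro bexI[of _ "v @ [(s, \<not> b)]"]) auto
qed

lemma pres_class_in_carrier:
  "u \<in> gwords S \<Longrightarrow> pres_rel S R `` {u} \<in> carrier (presented_group S R)"
  unfolding carrier_presented_group by (rule imageI)

lemma carrier_presented_groupE:
  assumes "A \<in> carrier (presented_group S R)"
  obtains u where "u \<in> gwords S" "A = pres_rel S R `` {u}"
  using assms unfolding carrier_presented_group by (rule imageE)

lemma group_presented_group: "group (presented_group S R)"
proof (rule groupI)
  show "\<one>\<^bsub>presented_group S R\<^esub> \<in> carrier (presented_group S R)"
    unfolding one_presented_group by (rule pres_class_in_carrier) simp
next
  fix A B assume "A \<in> carrier (presented_group S R)" "B \<in> carrier (presented_group S R)"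
  then show "A \<otimes>\<^bsub>presented_group S R\<^esub> B \<in> carrier (presented_group S R)"
    by (elim carrier_presented_groupE) (simp add: mult_presented_group pres_class_in_carrier)
next
  fix A B C
  assume "A \<in> carrier (presented_group S R)" "B \<in> carrier (presented_group S R)"
    "C \<in> carrier (presented_group S R)"
  then show "A \<otimes>\<^bsub>presented_group S R\<^esub> B \<otimes>\<^bsub>presented_group S R\<^esub> C =
      A \<otimes>\<^bsub>presented_group S R\<^esub> (B \<otimes>\<^bsub>presented_group S R\<^esub> C)"
    by (elim carrier_presented_groupE) (simp add: mult_presented_group)
next
  fix A assume "A \<in> carrier (presented_group S R)"
  then obtain u where u: "u \<in> gwords S" "A = pres_rel S R `` {u}"
    by (rule carrier_presented_groupE)
  then show "\<one>\<^bsub>presented_group S R\<^esub> \<otimes>\<^bsub>presented_group S R\<^esub> A = A"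
    by (simp add: mult_presented_group one_presented_group)
  obtain v where v: "v \<in> gwords S" "pres_eq S R (v @ u) []"
    using pres_eq_inverse_word[OF u(1)] by blast
  show "\<exists>B\<in>carrier (presented_group S R). B \<otimes>\<^bsub>presented_group S R\<^esub> A = \<one>\<^bsub>presented_group S R\<^esub>"
  proof
    show "pres_rel S R `` {v} \<otimes>\<^bsub>presented_group S R\<^esub> A = \<one>\<^bsub>presented_group S R\<^esub>"
      using u v by (simp add: mult_presented_group one_presented_group pres_class_eq_iff)
    show "pres_rel S R `` {v} \<in> carrier (presented_group S R)"
      using v(1) by (rule pres_class_in_carrier)
  qed
qed

text \<open>The universal property of the presentation.\<close>

definition eval_gword :: "('b, 'c) monoid_scheme \<Rightarrow> ('a \<Rightarrow> 'b) \<Rightarrow> 'a gword \<Rightarrow> 'b" where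
  "eval_gword G f u = foldr (\<lambda>(s, b) g. (if b then f s else inv\<^bsub>G\<^esub> f s) \<otimes>\<^bsub>G\<^esub> g) u \<one>\<^bsub>G\<^esub>"

lemma eval_gword_simps [simp]:
  "eval_gword G f [] = \<one>\<^bsub>G\<^esub>"
  "eval_gword G f ((s, b) # u) = (if b then f s else inv\<^bsub>G\<^esub> f s) \<otimes>\<^bsub>G\<^esub> eval_gword G f u"
  by (simp_all add: eval_gword_def)

context group
begin

lemma eval_gword_closed:
  "f \<in> S \<rightarrow> carrier G \<Longrightarrow> u \<in> gwords S \<Longrightarrow> eval_gword G f u \<in> carrier G"
  by (induction u) (auto simp: Pi_iff)

lemma eval_gword_append:
  "f \<in> S \<rightarrow> carrier G \<Longrightarrow> u \<in> gwords S \<Longrightarrow> v \<in> gwords S \<Longrightarrow>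
    eval_gword G f (u @ v) = eval_gword G f u \<otimes> eval_gword G f v"
  by (induction u) (auto simp: Pi_iff eval_gword_closed m_assoc)

lemma eval_gword_pres_eq:
  assumes f: "f \<in> S \<rightarrow> carrier G"
    and R: "\<And>u v. (u, v) \<in> R \<Longrightarrow> eval_gword G f u = eval_gword G f v"
  shows "pres_eq S R u v \<Longrightarrow> eval_gword G f u = eval_gword G f v"
proof (induction rule: pres_eq.induct)
  case (cancel s b)
  then have "f s \<in> carrier G" using f by auto
  then show ?case by simp
next
  case (append u v u' v')
  then show ?case by (metis eval_gword_append[OF f] pres_eq_gwords)
qed (use R in auto)

lemma presented_group_universal:
  assumes f: "f \<in> S \<rightarrow> carrier G"
    and R: "\<And>u v. (u, v) \<in> R \<Longrightarrow> eval_gword G f u = eval_gword G f v"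
  obtains h where "h \<in> hom (presented_group S R) G"
    and "\<And>u. u \<in> gwords S \<Longrightarrow> h (pres_rel S R `` {u}) = eval_gword G f u"
proof -
  define h where "h A = eval_gword G f (SOME u. u \<in> A)" for A
  have h: "h (pres_rel S R `` {u}) = eval_gword G f u" if "u \<in> gwords S" for u
  proof -
    have "pres_eq S R u u" using that by (rule pres_eq.refl)
    then have "pres_eq S R u (SOME v. v \<in> pres_rel S R `` {u})"
      by (metis (no_types, lifting) Image_singleton_iff case_prodI case_prodD mem_Collect_eq
          pres_rel_def someI)
    then show ?thesis using eval_gword_pres_eq[OF f R] by (metis h_def)
  qed
  have hom: "h \<in> hom (presented_group S R) G"
  proof (rule homI)
    fix A B assume "A \<in> carrier (presented_group S R)" "B \<in> carrier (presented_group S R)"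
    then show "h (A \<otimes>\<^bsub>presented_group S R\<^esub> B) = h A \<otimes> h B"
      by (elim carrier_presented_groupE)
        (simp add: mult_presented_group h eval_gword_append[OF f])
  next
    fix A assume "A \<in> carrier (presented_group S R)"
    then show "h A \<in> carrier G"
      by (elim carrier_presented_groupE) (simp add: h eval_gword_closed[OF f])
  qed
  show thesis by (rule that[OF hom]) (rule h)
qed

end


section \<open>Simplicial graphs\<close>

definition simplicial_graph :: "'a set \<Rightarrow> 'a set set \<Rightarrow> bool" where
  "simplicial_graph V E \<longleftrightarrow> (\<forall>e\<in>E. \<exists>x\<in>V. \<exists>y\<in>V. x \<noteq> y \<and> e = {x, y})"

definition complete_graph :: "'a set \<Rightarrow> 'a set set \<Rightarrow> bool" where
  "complete_graph V E \<longleftrightarrow> (\<forall>x\<in>V. \<forall>y\<in>V. x \<noteq> y \<longrightarrow> {x, y} \<in> E)"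

definition star_verts :: "'a set \<Rightarrow> 'a set set \<Rightarrow> 'a \<Rightarrow> 'a set" where
  "star_verts V E x = insert x {y\<in>V. {x, y} \<in> E}"

definition full_subgraph_edges :: "'a set set \<Rightarrow> 'a set \<Rightarrow> 'a set set" where
  "full_subgraph_edges E U = {e\<in>E. e \<subseteq> U}"

definition star_edges :: "'a set \<Rightarrow> 'a set set \<Rightarrow> 'a \<Rightarrow> 'a set set" where
  "star_edges V E x = full_subgraph_edges E (star_verts V E x)"

definition graph_automorphism :: "'a set \<Rightarrow> 'a set set \<Rightarrow> ('a \<Rightarrow> 'a) \<Rightarrow> bool" where
  "graph_automorphism V E f \<longleftrightarrow>
    bij_betw f V V \<and> (\<forall>x\<in>V. \<forall>y\<in>V. {x, y} \<in> E \<longleftrightarrow> {f x, f y} \<in> E)"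


section \<open>Trickle graphs and trickle groups\<close>

text \<open>
  Only the values of \<open>leq\<close> and \<open>\<mu>\<close> on \<open>V\<close>, and those of \<open>\<phi> x\<close> on the star of \<open>x\<close> for \<open>x \<in> V\<close>,
  are meaningful. The order of \<open>\<phi> x\<close> is taken in the group of permutations of the star of \<open>x\<close>;
  there \<^const>\<open>group.ord\<close> is \<open>0\<close> for elements of infinite order.
\<close>

locale trickle_graph =
  fixes V :: "'a set"
    and E :: "'a set set"
    and leq :: "'a \<Rightarrow> 'a \<Rightarrow> bool" (infix "\<preceq>" 50)
    and \<mu> :: "'a \<Rightarrow> enat"
    and \<phi> :: "'a \<Rightarrow> 'a \<Rightarrow> 'a"
  assumes graph: "simplicial_graph V E"
    and order: "partial_order_on V {(x, y). x \<in> V \<and> y \<in> V \<and> x \<preceq> y}"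
    and label_ge_2: "x \<in> V \<Longrightarrow> 2 \<le> \<mu> x"
    and automorphism:
      "x \<in> V \<Longrightarrow> graph_automorphism (star_verts V E x) (star_edges V E x) (\<phi> x)"
    and less_edge: "\<lbrakk>x \<in> V; y \<in> V; x \<preceq> y; x \<noteq> y\<rbrakk> \<Longrightarrow> {x, y} \<in> E"
    and parallel_down:
      "\<lbrakk>x \<in> V; y \<in> V; z \<in> V; {x, y} \<in> E; \<not> x \<preceq> y; \<not> y \<preceq> x; z \<preceq> y\<rbrakk>
        \<Longrightarrow> {x, z} \<in> E \<and> \<not> x \<preceq> z \<and> \<not> z \<preceq> x"
    and order_preserved:
      "\<lbrakk>x \<in> V; y \<in> star_verts V E x; z \<in> star_verts V E x\<rbrakk>
        \<Longrightarrow> z \<preceq> y \<longleftrightarrow> \<phi> x z \<preceq> \<phi> x y"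
    and moved_less:
      "\<lbrakk>x \<in> V; y \<in> star_verts V E x; \<phi> x y \<noteq> y\<rbrakk> \<Longrightarrow> y \<preceq> x \<and> y \<noteq> x"
    and finite_order:
      "\<lbrakk>x \<in> V; \<mu> x = enat n\<rbrakk> \<Longrightarrow>
        group.ord (BijGroup (star_verts V E x)) (restrict (\<phi> x) (star_verts V E x)) \<noteq> 0 \<and>
        group.ord (BijGroup (star_verts V E x)) (restrict (\<phi> x) (star_verts V E x)) dvd n"
    and label_preserved: "\<lbrakk>x \<in> V; y \<in> star_verts V E x\<rbrakk> \<Longrightarrow> \<mu> (\<phi> x y) = \<mu> y"
    and compatible:
      "\<lbrakk>x \<in> V; y \<in> V; z \<in> V; z \<preceq> y; z \<noteq> y; y \<preceq> x; y \<noteq> x\<rbrakk>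
        \<Longrightarrow> \<phi> x (\<phi> y z) = \<phi> (\<phi> x y) (\<phi> x z)"

definition trickle_relations ::
  "'a set \<Rightarrow> 'a set set \<Rightarrow> ('a \<Rightarrow> enat) \<Rightarrow> ('a \<Rightarrow> 'a \<Rightarrow> 'a) \<Rightarrow> ('a gword \<times> 'a gword) set" where
  "trickle_relations V E \<mu> \<phi> =
    {(replicate n (x, True), []) | x n. x \<in> V \<and> \<mu> x = enat n} \<union>
    {([(\<phi> x y, True), (x, True)], [(\<phi> y x, True), (y, True)]) | x y.
      x \<in> V \<and> y \<in> V \<and> {x, y} \<in> E}"

definition trickle_group ::
  "'a set \<Rightarrow> 'a set set \<Rightarrow> ('a \<Rightarrow> enat) \<Rightarrow> ('a \<Rightarrow> 'a \<Rightarrow> 'a) \<Rightarrow> 'a gword set monoid" where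
  "trickle_group V E \<mu> \<phi> = presented_group V (trickle_relations V E \<mu> \<phi>)"

text \<open>
  No trickle relation is ignored by \<^const>\<open>pres_eq\<close>, and the divisibility condition on the order
  of \<open>\<phi> x\<close> says that the corresponding iterate is the identity.
\<close>

context trickle_graph
begin

lemma bij_betw_star: "x \<in> V \<Longrightarrow> bij_betw (\<phi> x) (star_verts V E x) (star_verts V E x)"
  using automorphism by (simp add: graph_automorphism_def)

lemma phi_adjacent_in_verts:
  assumes "x \<in> V" "y \<in> V" "{x, y} \<in> E"
  shows "\<phi> x y \<in> V"
proof -
  have "y \<in> star_verts V E x" using assms by (simp add: star_verts_def)
  then have "\<phi> x y \<in> star_verts V E x" by (rule bij_betw_apply[OF bij_betw_star[OF assms(1)]])
  then show ?thesis using assms(1) by (auto simp: star_verts_def)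
qed

lemma trickle_relations_gwords:
  assumes "(u, v) \<in> trickle_relations V E \<mu> \<phi>"
  shows "u \<in> gwords V \<and> v \<in> gwords V"
proof -
  consider x n where "x \<in> V" "u = replicate n (x, True)" "v = []"
    | x y where "x \<in> V" "y \<in> V" "{x, y} \<in> E"
      "u = [(\<phi> x y, True), (x, True)]" "v = [(\<phi> y x, True), (y, True)]"
    using assms unfolding trickle_relations_def by blast
  then show ?thesis
  proof cases
    case 1
    then show ?thesis by (auto simp: gwords_def)
  next
    case 2
    then have "{y, x} \<in> E" by (metis insert_commute)
    with 2 show ?thesis by (simp add: phi_adjacent_in_verts)
  qed
qed

lemma funpow_label:
  assumes x: "x \<in> V" and n: "\<mu> x = enat n" and y: "y \<in> star_verts V E x"
  shows "(\<phi> x ^^ n) y = y"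
proof -
  let ?S = "star_verts V E x"
  let ?f = "restrict (\<phi> x) ?S"
  note bij = bij_betw_star[OF x]
  have f: "?f \<in> Bij ?S"
    using bij by (simp add: Bij_def cong: bij_betw_cong)
  interpret group "BijGroup ?S" by (rule group_BijGroup)
  have mult_Bij: "g \<otimes>\<^bsub>BijGroup ?S\<^esub> h = compose ?S g h" if "g \<in> Bij ?S" "h \<in> Bij ?S" for g h
    using that by (simp add: BijGroup_def)
  have pow: "?f [^]\<^bsub>BijGroup ?S\<^esub> k \<in> Bij ?S \<and>
    (\<forall>y\<in>?S. (?f [^]\<^bsub>BijGroup ?S\<^esub> k) y = (\<phi> x ^^ k) y)"
    for k :: nat
  proof (induction k)
    case 0
    have "?f [^]\<^bsub>BijGroup ?S\<^esub> (0::nat) = (\<lambda>y\<in>?S. y)"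
      by (simp only: nat_pow_0) (simp add: BijGroup_def)
    moreover have "(\<lambda>y\<in>?S. y) \<in> Bij ?S"
      by (rule id_Bij)
    ultimately show ?case
      by (auto simp only: funpow_0 restrict_apply')
  next
    case (Suc k)
    let ?g = "?f [^]\<^bsub>BijGroup ?S\<^esub> k"
    have "?f [^]\<^bsub>BijGroup ?S\<^esub> Suc k = compose ?S ?g ?f"
      using mult_Bij[OF _ f, of ?g] Suc.IH by (simp only: nat_pow_Suc)
    moreover have "compose ?S ?g ?f \<in> Bij ?S"
      by (rule compose_Bij[OF conjunct1[OF Suc.IH] f])
    moreover have "compose ?S ?g ?f y = (\<phi> x ^^ Suc k) y" if "y \<in> ?S" for y
    proof -
      have "\<phi> x y \<in> ?S" using bij that by (rule bij_betw_apply)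
      then show ?thesis
        using conjunct2[OF Suc.IH] that
        by (simp only: compose_eq restrict_apply' funpow_Suc_right o_apply)
    qed
    ultimately show ?case by (auto simp only:)
  qed
  have "?f [^]\<^bsub>BijGroup ?S\<^esub> n = \<one>\<^bsub>BijGroup ?S\<^esub>"
    using finite_order[OF x n] f by (subst pow_eq_id) (auto simp: BijGroup_def)
  then show ?thesis using pow[of n] y by (auto simp: BijGroup_def)
qed

end

end

theory Submission
  imports Defs Complex_Main
begin

text \<open>
  The proof avoids normal forms for trickle groups: a few explicit actions suffice.

  Extend each \<open>\<phi> x\<close> by the identity to a permutation of all vertices. These permutations satisfy
  the trickle relations, so the group acts on \<open>V\<close>. The generator \<open>x\<close> fixes the vertex \<open>x\<close> (and
  moves only vertices below it), which leaves room for a twist: attach a complex coordinate \<open>t\<close> to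
  a vertex \<open>p\<close>, permute the vertex, and multiply \<open>t\<close> by a constant \<open>\<zeta> p \<noteq> 1\<close> when \<open>x = p\<close>. With \<open>\<zeta> p\<close>
  a root of unity of order \<open>\<mu> p\<close>, or \<open>2\<close> when \<open>\<mu> p = \<infinity>\<close>, the relations still hold, because \<open>\<mu>\<close> is
  constant on orbits. Distinct generators act differently, and a generator with infinite label has
  infinite order; so a finite trickle group has finitely many vertices and finite labels
  (\<open>finite_group_imp_finite_vertices\<close>).

  The same construction works over pairs of vertices that are not joined by an edge: on \<open>(p, q, t)\<close>
  the generators \<open>p\<close> and \<open>q\<close> rotate the complex plane about \<open>0\<close> and about \<open>1\<close>. They need not
  commute, since no relation involves the two of them, and two nontrivial rotations about different
  centres have a nontrivial translation as commutator: the image is infinite. What is needed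
  is a set of such pairs that all the vertex permutations preserve. Once \<open>V\<close> is known to be finite,
  take the non-adjacent pairs of maximal elements of the set \<open>S\<close> of vertices that are not adjacent
  to every other vertex. A generator in
  \<open>S\<close> fixes them, because it moves only vertices strictly below itself; a generator outside \<open>S\<close> has
  the whole of \<open>V\<close> as its star, hence acts as an automorphism of the ordered graph. If the graph is
  not complete, such a pair exists because non-adjacency passes upwards to maximal elements
  (\<open>exists_top_nonedge\<close>). So a finite trickle group has a complete graph.

  Conversely, in a complete graph a maximal vertex \<open>x\<close> can be moved to the left past any other
  generator \<open>y\<close>, as \<open>y x = x z\<close> with \<open>z\<close> equal to \<open>y\<close> or below \<open>x\<close>. By induction over down-closed
  sets, every element is a product of powers \<open>x\<^sup>i\<close> with \<open>i < \<mu> x\<close>, one for each vertex and in a fixed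
  order, and there are finitely many of these (\<open>down_set_finite_closed\<close>).
\<close>

section \<open>Actions of trickle groups\<close>

lemma funpow_repeats:
  assumes H: "finite H" "f \<in> H" "\<And>f g. f \<in> H \<Longrightarrow> g \<in> H \<Longrightarrow> f \<circ> g \<in> H"
  obtains m n where "m < n" "f ^^ m = f ^^ n"
proof -
  have "f ^^ Suc n \<in> H" for n
    using H(2,3) by (induction n) auto
  then have "(\<lambda>n. f ^^ Suc n) ` UNIV \<subseteq> H" by blast
  then have "finite ((\<lambda>n. f ^^ Suc n) ` UNIV)" using H(1) finite_subset by blast
  then have "\<not> inj (\<lambda>n. f ^^ Suc n)" using finite_imageD infinite_UNIV_nat by blast
  then obtain m n where "m \<noteq> n" "f ^^ Suc m = f ^^ Suc n" by (auto simp: inj_def)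
  then show thesis using that[of "Suc m" "Suc n"] that[of "Suc n" "Suc m"]
    by (metis Suc_mono nat_neq_iff)
qed

context trickle_graph
begin

lemma vertex_order:
  shows leq_refl: "x \<in> V \<Longrightarrow> x \<preceq> x"
    and leq_antisym: "\<lbrakk>x \<in> V; y \<in> V; x \<preceq> y; y \<preceq> x\<rbrakk> \<Longrightarrow> x = y"
    and leq_trans: "\<lbrakk>x \<in> V; y \<in> V; z \<in> V; x \<preceq> y; y \<preceq> z\<rbrakk> \<Longrightarrow> x \<preceq> z"
  using order unfolding partial_order_on_def preorder_on_def refl_on_def trans_def antisym_def
  by blast+

lemma edge_neq: "{x, y} \<in> E \<Longrightarrow> x \<noteq> y"
  using graph unfolding simplicial_graph_def by fastforce

lemma star_subset: "x \<in> V \<Longrightarrow> star_verts V E x \<subseteq> V"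
  by (auto simp: star_verts_def)

lemma leq_in_star: "\<lbrakk>x \<in> V; y \<in> V; y \<preceq> x\<rbrakk> \<Longrightarrow> y \<in> star_verts V E x"
  using less_edge[of y x] by (auto simp: star_verts_def insert_commute)

lemma phi_self: "x \<in> V \<Longrightarrow> \<phi> x x = x"
  using moved_less[of x x] by (auto simp: star_verts_def)

text \<open>
  By the universal property, bijections that satisfy the relations define a homomorphism into the
  permutations, and \<open>H\<close> is its image. The edge relations are asked for in the shape they take
  once the trivial factors \<open>\<phi> y x = x\<close> are removed: a twisted commutation below, and an honest one
  for incomparable vertices.
\<close>

lemma finite_perm_group_of_action:
  fixes T :: "'a \<Rightarrow> 'b \<Rightarrow> 'b"
  assumes fin: "finite (carrier (trickle_group V E \<mu> \<phi>))"
    and bij: "\<And>x. x \<in> V \<Longrightarrow> bij (T x)"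
    and label: "\<And>x n. \<lbrakk>x \<in> V; \<mu> x = enat n\<rbrakk> \<Longrightarrow> T x ^^ n = id"
    and down: "\<And>x y. \<lbrakk>x \<in> V; y \<in> V; y \<preceq> x; y \<noteq> x\<rbrakk> \<Longrightarrow> T (\<phi> x y) \<circ> T x = T x \<circ> T y"
    and parallel: "\<And>x y. \<lbrakk>x \<in> V; y \<in> V; {x, y} \<in> E; \<not> x \<preceq> y; \<not> y \<preceq> x\<rbrakk>
      \<Longrightarrow> T x \<circ> T y = T y \<circ> T x"
  obtains H where "finite H" "T ` V \<subseteq> H" "\<And>f. f \<in> H \<Longrightarrow> bij f"
    "\<And>f g. f \<in> H \<Longrightarrow> g \<in> H \<Longrightarrow> f \<circ> g \<in> H" "\<And>f. f \<in> H \<Longrightarrow> inv_into UNIV f \<in> H"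
proof -
  let ?B = "BijGroup (UNIV :: 'b set)"
  interpret B: group ?B by (rule group_BijGroup)
  have carrier: "carrier ?B = {f. bij f}"
    by (auto simp: BijGroup_def Bij_def extensional_def)
  have mult: "f \<otimes>\<^bsub>?B\<^esub> g = f \<circ> g" if "bij f" "bij g" for f g
    using that by (auto simp: BijGroup_def Bij_def extensional_def compose_def)
  have one: "\<one>\<^bsub>?B\<^esub> = id" by (auto simp: BijGroup_def)
  have T: "T \<in> V \<rightarrow> carrier ?B" using bij carrier by auto
  have edge: "T (\<phi> x y) \<circ> T x = T (\<phi> y x) \<circ> T y"
    if xy: "x \<in> V" "y \<in> V" "{x, y} \<in> E" for x y
  proof -
    have star: "y \<in> star_verts V E x" "x \<in> star_verts V E y"
      using xy by (auto simp: star_verts_def insert_commute)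
    have fix_y: "\<phi> x y = y" if "\<not> (y \<preceq> x)"
      using moved_less[OF \<open>x \<in> V\<close> star(1)] that by auto
    have fix_x: "\<phi> y x = x" if "\<not> (x \<preceq> y)"
      using moved_less[OF \<open>y \<in> V\<close> star(2)] that by auto
    have "x \<noteq> y" using xy edge_neq by blast
    consider "y \<preceq> x" "\<not> x \<preceq> y" | "x \<preceq> y" "\<not> y \<preceq> x" | "\<not> x \<preceq> y" "\<not> y \<preceq> x"
      using leq_antisym xy \<open>x \<noteq> y\<close> by blast
    then show ?thesis
    proof cases
      case 1
      then show ?thesis using down[of x y] xy \<open>x \<noteq> y\<close> fix_x by simp
    next
      case 2
      then show ?thesis using down[of y x] xy \<open>x \<noteq> y\<close> fix_y by simp
    next
      case 3
      then show ?thesis using parallel[of x y] xy fix_x fix_y by simp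
    qed
  qed
  have eval_power: "eval_gword ?B T (replicate n (x, True)) = T x ^^ n" if "x \<in> V" for n x
  proof (induction n)
    case 0
    then show ?case by (simp add: one)
  next
    case (Suc n)
    then show ?case using mult[OF bij[OF that] bij_fn[OF bij[OF that]]] by simp
  qed
  have rel: "eval_gword ?B T u = eval_gword ?B T v"
    if uv: "(u, v) \<in> trickle_relations V E \<mu> \<phi>" for u v
  proof -
    consider x n where "x \<in> V" "\<mu> x = enat n" "u = replicate n (x, True)" "v = []"
      | x y where "x \<in> V" "y \<in> V" "{x, y} \<in> E"
        "u = [(\<phi> x y, True), (x, True)]" "v = [(\<phi> y x, True), (y, True)]"
      using uv unfolding trickle_relations_def by blast
    then show ?thesis
    proof cases
      case 1
      then show ?thesis using eval_power label one by simp
    next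
      case 2
      have "{y, x} \<in> E" using 2(3) by (simp add: insert_commute)
      then show ?thesis
        using 2 T phi_adjacent_in_verts[of x y] phi_adjacent_in_verts[of y x] edge[of x y] bij
        by (auto simp: mult carrier Pi_iff)
    qed
  qed
  obtain h where h: "h \<in> hom (trickle_group V E \<mu> \<phi>) ?B"
    "\<And>u. u \<in> gwords V \<Longrightarrow>
      h (pres_rel V (trickle_relations V E \<mu> \<phi>) `` {u}) = eval_gword ?B T u"
    using B.presented_group_universal[OF T rel] unfolding trickle_group_def by metis
  let ?H = "h ` carrier (trickle_group V E \<mu> \<phi>)"
  interpret h: group_hom "trickle_group V E \<mu> \<phi>" ?B h
    using h(1) group_presented_group
    by (auto simp: group_hom_def group_hom_axioms_def trickle_group_def B.is_group)
  have sub: "subgroup ?H ?B" by (rule h.img_is_subgroup)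
  have bijH: "bij f" if "f \<in> ?H" for f
    using subgroup.mem_carrier[OF sub that] carrier by simp
  show thesis
  proof (rule that)
    show "finite ?H" using fin by simp
    show "T ` V \<subseteq> ?H"
    proof
      fix f assume "f \<in> T ` V"
      then obtain x where x: "x \<in> V" "f = T x" by auto
      then have "h (pres_rel V (trickle_relations V E \<mu> \<phi>) `` {[(x, True)]}) = f"
        using T by (subst h(2)) (auto simp: Pi_iff)
      moreover have "pres_rel V (trickle_relations V E \<mu> \<phi>) `` {[(x, True)]}
          \<in> carrier (trickle_group V E \<mu> \<phi>)"
        unfolding trickle_group_def using x by (intro pres_class_in_carrier) simp
      ultimately show "f \<in> ?H" by blast
    qed
    show "bij f" if "f \<in> ?H" for f using bijH that .
    show "f \<circ> g \<in> ?H" if "f \<in> ?H" "g \<in> ?H" for f g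
      using subgroup.m_closed[OF sub that] mult bijH that by simp
    show "inv_into UNIV f \<in> ?H" if "f \<in> ?H" for f
    proof -
      have f: "bij f" using bijH that .
      have "inv_into UNIV f \<otimes>\<^bsub>?B\<^esub> f = \<one>\<^bsub>?B\<^esub>"
        using f by (simp add: mult one bij_imp_bij_inv bij_is_inj)
      then have "inv\<^bsub>?B\<^esub> f = inv_into UNIV f"
        using f carrier by (intro B.inv_equality) (auto simp: bij_imp_bij_inv)
      then show ?thesis using subgroup.m_inv_closed[OF sub that] by simp
    qed
  qed
qed

section \<open>Permutations of the vertex set\<close>

definition vertex_perm :: "'a \<Rightarrow> 'a \<Rightarrow> 'a" where
  "vertex_perm x y = (if y \<in> star_verts V E x then \<phi> x y else y)"

lemma bij_vertex_perm:
  assumes "x \<in> V" shows "bij (vertex_perm x)"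
proof -
  let ?S = "star_verts V E x"
  have "bij_betw (vertex_perm x) ?S ?S"
    using bij_betw_star[OF assms] by (simp add: vertex_perm_def cong: bij_betw_cong)
  moreover have "bij_betw (vertex_perm x) (- ?S) (- ?S)"
    by (rule bij_betwI[where g = id]) (auto simp: vertex_perm_def)
  ultimately have "bij_betw (vertex_perm x) (?S \<union> - ?S) (?S \<union> - ?S)"
    by (rule bij_betw_combine) auto
  then show ?thesis by simp
qed

lemma vertex_perm_eq_iff: "x \<in> V \<Longrightarrow> vertex_perm x y = vertex_perm x z \<longleftrightarrow> y = z"
  using bij_vertex_perm by (metis bij_pointE)

lemma vertex_perm_star_iff:
  "x \<in> V \<Longrightarrow> vertex_perm x y \<in> star_verts V E x \<longleftrightarrow> y \<in> star_verts V E x"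
  using bij_betw_apply[OF bij_betw_star] by (auto simp: vertex_perm_def)

lemma vertex_perm_fixed: "\<lbrakk>x \<in> V; \<not> (y \<preceq> x \<and> y \<noteq> x)\<rbrakk> \<Longrightarrow> vertex_perm x y = y"
  using moved_less by (auto simp: vertex_perm_def)

lemma vertex_perm_below: "\<lbrakk>x \<in> V; y \<in> V; y \<preceq> x\<rbrakk> \<Longrightarrow> vertex_perm x y = \<phi> x y"
  using leq_in_star by (simp add: vertex_perm_def)

lemma vertex_perm_in_V_iff: "x \<in> V \<Longrightarrow> vertex_perm x y \<in> V \<longleftrightarrow> y \<in> V"
  using vertex_perm_star_iff[of x y] star_subset[of x] by (auto simp: vertex_perm_def)

lemma vertex_perm_label: "x \<in> V \<Longrightarrow> \<mu> (vertex_perm x y) = \<mu> y"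
  using label_preserved by (simp add: vertex_perm_def)

lemma vertex_perm_leq_iff:
  assumes "x \<in> V" "y \<in> star_verts V E x" "z \<in> star_verts V E x"
  shows "vertex_perm x z \<preceq> vertex_perm x y \<longleftrightarrow> z \<preceq> y"
  using assms order_preserved by (simp add: vertex_perm_def)

lemma vertex_perm_leq_self_iff:
  assumes "x \<in> V" "y \<in> V"
  shows "vertex_perm x y \<preceq> x \<longleftrightarrow> y \<preceq> x"
proof (cases "y \<in> star_verts V E x")
  case True
  then show ?thesis
    using vertex_perm_leq_iff[of x x y] assms vertex_perm_fixed[of x x]
    by (auto simp: star_verts_def)
qed (simp add: vertex_perm_def)

lemma vertex_perm_funpow:
  assumes "x \<in> V" "\<mu> x = enat n"
  shows "vertex_perm x ^^ n = id"
proof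
  fix y
  show "(vertex_perm x ^^ n) y = id y"
  proof (cases "y \<in> star_verts V E x")
    case True
    have "(vertex_perm x ^^ k) y = (\<phi> x ^^ k) y \<and> (\<phi> x ^^ k) y \<in> star_verts V E x" for k
      using True bij_betw_apply[OF bij_betw_star[OF assms(1)]]
      by (induction k) (auto simp: vertex_perm_def)
    then show ?thesis using funpow_label[OF assms True] by simp
  next
    case False
    then have "(vertex_perm x ^^ k) y = y" for k
      by (induction k) (auto simp: vertex_perm_def)
    then show ?thesis by simp
  qed
qed

text \<open>
  For \<open>z\<close> below \<open>y\<close> this is the compatibility axiom. In all other cases \<open>y\<close> fixes \<open>z\<close>, and then \<open>\<phi> x y\<close>
  fixes the image of \<open>z\<close>, because \<open>x\<close> preserves the order on its star and nothing outside the star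
  is below \<open>\<phi> x y\<close>.
\<close>

lemma vertex_perm_down:
  assumes x: "x \<in> V" and y: "y \<in> V" "y \<preceq> x" "y \<noteq> x" and z: "z \<in> V"
  shows "vertex_perm (\<phi> x y) (vertex_perm x z) = vertex_perm x (vertex_perm y z)"
proof -
  let ?y = "\<phi> x y"
  have y': "vertex_perm x y = ?y" using x y vertex_perm_below by simp
  have y'V: "?y \<in> V" "?y \<preceq> x"
    using vertex_perm_in_V_iff[of x y] vertex_perm_leq_self_iff[of x y] x y y' by auto
  show ?thesis
  proof (cases "z \<preceq> y \<and> z \<noteq> y")
    case True
    then have zx: "z \<preceq> x" using leq_trans x y z by blast
    have pz: "vertex_perm y z \<in> V" "vertex_perm y z \<preceq> x"
      using vertex_perm_in_V_iff[of y z] vertex_perm_leq_self_iff[of y z] True y z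
        leq_trans[of _ y x] x by auto
    have px: "vertex_perm x z \<in> V" using vertex_perm_in_V_iff[of x z] x z by simp
    have "vertex_perm x z \<preceq> ?y"
      using vertex_perm_leq_iff[of x y z] leq_in_star x y z zx True y' by metis
    then have "vertex_perm ?y (vertex_perm x z) = \<phi> ?y (\<phi> x z)"
      using vertex_perm_below[OF y'V(1) px] vertex_perm_below[OF x z zx] by simp
    also have "\<dots> = \<phi> x (\<phi> y z)" using compatible[of x y z] True x y z by simp
    also have "\<dots> = vertex_perm x (vertex_perm y z)"
      using vertex_perm_below[OF x pz] vertex_perm_below[of y z] y z True by simp
    finally show ?thesis .
  next
    case False
    have "\<not> (vertex_perm x z \<preceq> ?y \<and> vertex_perm x z \<noteq> ?y)"
    proof
      assume *: "vertex_perm x z \<preceq> ?y \<and> vertex_perm x z \<noteq> ?y"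
      then have "vertex_perm x z \<preceq> x"
        using leq_trans[of "vertex_perm x z" ?y x] y'V x vertex_perm_in_V_iff[of x z] z by simp
      then have "z \<preceq> x" using vertex_perm_leq_self_iff x z by simp
      then have "z \<preceq> y"
        using vertex_perm_leq_iff[of x y z] leq_in_star x y z * y' by metis
      then show False using False * y' by auto
    qed
    then show ?thesis
      using vertex_perm_fixed[OF y'V(1), of "vertex_perm x z"] vertex_perm_fixed[of y z] False y
      by simp
  qed
qed

text \<open>
  Incomparable adjacent vertices have no common lower bound, since everything below one of them is
  incomparable to the other. So the two permutations have disjoint supports.
\<close>

lemma vertex_perm_parallel:
  assumes "x \<in> V" "y \<in> V" "{x, y} \<in> E" "\<not> x \<preceq> y" "\<not> y \<preceq> x" and z: "z \<in> V"
  shows "vertex_perm x (vertex_perm y z) = vertex_perm y (vertex_perm x z)"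
proof -
  have disj: "\<not> (w \<preceq> x \<and> w \<preceq> y)" if "w \<in> V" for w
    using parallel_down[of x y w] assms that by blast
  show ?thesis
    using disj[OF z] vertex_perm_fixed[of x] vertex_perm_fixed[of y]
      vertex_perm_leq_self_iff[of x z] vertex_perm_leq_self_iff[of y z] 
      vertex_perm_in_V_iff[of x z] vertex_perm_in_V_iff[of y z] disj assms
    by (metis)
qed

section \<open>Affine actions over sets of non-adjacent pairs\<close>

text \<open>
  The value depends on the label only, so it is constant on the orbits of the vertex permutations.
\<close>

definition label_root :: "'a \<Rightarrow> complex" where
  "label_root x = (case \<mu> x of enat n \<Rightarrow> cis (2 * pi / n) | \<infinity> \<Rightarrow> 2)"

lemma label_root_power: "\<mu> x = enat n \<Longrightarrow> label_root x ^ n = 1"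
  by (cases "n = 0") (auto simp: label_root_def DeMoivre)

lemma label_root_nonzero: "label_root x \<noteq> 0"
  by (auto simp: label_root_def split: enat.split)

lemma label_root_neq_1:
  assumes "x \<in> V" shows "label_root x \<noteq> 1"
proof (cases "\<mu> x")
  case (enat n)
  then have n: "2 \<le> n" using label_ge_2[OF assms] by (simp add: numeral_eq_enat)
  have "cis (2 * pi / n) \<noteq> 1"
  proof
    assume "cis (2 * pi / n) = 1"
    then have "cos (2 * pi / n) = 1" by (simp add: complex_eq_iff)
    then obtain k :: int where "2 * pi / n = k * 2 * pi"
      by (auto simp: cos_one_2pi_int)
    then have "1 = real_of_int k * n" using n by (simp add: field_simps)
    then have "1 = k * int n" by (metis of_int_1 of_int_eq_iff of_int_mult of_int_of_nat_eq)
    then have "int n dvd 1" by (metis dvd_triv_right)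
    then show False using n by simp
  qed
  then show ?thesis using enat by (simp add: label_root_def)
qed (simp add: label_root_def)


text \<open>
  Rotation about \<open>0\<close> for \<open>p\<close> and about \<open>1\<close> for \<open>q\<close>. The case \<open>p = q\<close>, in which only the first branch
  applies, serves to tell single vertices apart.
\<close>

definition pair_twist :: "'a \<Rightarrow> 'a \<Rightarrow> 'a \<Rightarrow> complex \<Rightarrow> complex" where
  "pair_twist x p q t =
    (if x = p then label_root p * t else if x = q then label_root q * (t - 1) + 1 else t)"

definition pair_move :: "('a \<times> 'a) set \<Rightarrow> 'a \<Rightarrow> 'a \<times> 'a \<times> complex \<Rightarrow> 'a \<times> 'a \<times> complex" where
  "pair_move Z x = (\<lambda>(p, q, t). if (p, q) \<in> Z
    then (vertex_perm x p, vertex_perm x q, pair_twist x p q t) else (p, q, t))"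

text \<open>
  Loops are not edges, so pairs \<open>(p, p)\<close> are permitted here.
\<close>

definition invariant_nonedges :: "('a \<times> 'a) set \<Rightarrow> bool" where
  "invariant_nonedges Z \<longleftrightarrow> Z \<subseteq> V \<times> V \<and> (\<forall>(p, q)\<in>Z. {p, q} \<notin> E) \<and>
    (\<forall>x\<in>V. \<forall>p q. (vertex_perm x p, vertex_perm x q) \<in> Z \<longleftrightarrow> (p, q) \<in> Z)"

lemma pair_twist_vertex_perm:
  "z \<in> V \<Longrightarrow> pair_twist (vertex_perm z x) (vertex_perm z p) (vertex_perm z q) = pair_twist x p q"
  by (simp add: pair_twist_def fun_eq_iff vertex_perm_eq_iff label_root_def vertex_perm_label)

lemma pair_twist_fixing:
  "\<lbrakk>z \<in> V; vertex_perm z x = x\<rbrakk>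
    \<Longrightarrow> pair_twist x (vertex_perm z p) (vertex_perm z q) = pair_twist x p q"
  using pair_twist_vertex_perm[of z x] by simp

text \<open>
  The twists by the members of the pair are the only ones that interact, and an edge cannot consist
  of those two.
\<close>

lemma pair_twist_commute:
  "\<lbrakk>{x, y} \<in> E; {p, q} \<notin> E\<rbrakk>
    \<Longrightarrow> pair_twist x p q (pair_twist y p q t) = pair_twist y p q (pair_twist x p q t)"
  by (auto simp: pair_twist_def insert_commute)

lemma pair_twist_funpow:
  "(pair_twist x p q ^^ n) t =
    (if x = p then label_root p ^ n * t
     else if x = q then label_root q ^ n * (t - 1) + 1 else t)"
  by (induction n) (auto simp: pair_twist_def)

lemma bij_pair_twist: "bij (pair_twist x p q)"
proof (rule bijI)
  show "inj (pair_twist x p q)"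
    by (rule injI) (auto simp: pair_twist_def label_root_nonzero split: if_splits)
  show "surj (pair_twist x p q)"
    by (rule surjI[of _ "\<lambda>t. if x = p then t / label_root p
        else if x = q then (t - 1) / label_root q + 1 else t"])
      (auto simp: pair_twist_def label_root_nonzero)
qed

lemma bij_pair_move:
  assumes Z: "invariant_nonedges Z" and x: "x \<in> V"
  shows "bij (pair_move Z x)"
proof (rule bijI)
  have Z_iff: "(vertex_perm x p, vertex_perm x q) \<in> Z \<longleftrightarrow> (p, q) \<in> Z" for p q
    using Z x by (simp add: invariant_nonedges_def)
  show "inj (pair_move Z x)"
  proof (rule injI)
    fix s s' assume "pair_move Z x s = pair_move Z x s'"
    moreover obtain p q t p' q' t' where "s = (p, q, t)" "s' = (p', q', t')"
      by (metis prod_cases3)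
    ultimately show "s = s'"
      using Z_iff[of p q] Z_iff[of p' q'] bij_is_inj[OF bij_pair_twist, of x p q]
      by (auto simp: pair_move_def vertex_perm_eq_iff[OF x] inj_def split: if_splits)
  qed
  show "surj (pair_move Z x)"
  proof (rule surjI[of _ "\<lambda>s. SOME r. pair_move Z x r = s"], rule someI_ex)
    fix s :: "'a \<times> 'a \<times> complex"
    obtain p q t where s: "s = (p, q, t)" by (metis prod_cases3)
    show "\<exists>r. pair_move Z x r = s"
    proof (cases "(p, q) \<in> Z")
      case True
      obtain p0 q0 where "p = vertex_perm x p0" "q = vertex_perm x q0"
        using bij_is_surj[OF bij_vertex_perm[OF x]] by (meson surjD)
      moreover obtain t0 where "t = pair_twist x p0 q0 t0"
        using bij_is_surj[OF bij_pair_twist] by (meson surjD)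
      ultimately have "pair_move Z x (p0, q0, t0) = s"
        using s True Z_iff by (simp add: pair_move_def)
      then show ?thesis ..
    next
      case False
      then have "pair_move Z x s = s" using s by (simp add: pair_move_def)
      then show ?thesis ..
    qed
  qed
qed

lemma pair_move_funpow:
  assumes Z: "invariant_nonedges Z" and x: "x \<in> V" and pq: "(p, q) \<in> Z"
  shows "(pair_move Z x ^^ n) (p, q, t) =
    ((vertex_perm x ^^ n) p, (vertex_perm x ^^ n) q, (pair_twist x p q ^^ n) t)"
proof -
  have "(pair_move Z x ^^ n) (p, q, t) =
      ((vertex_perm x ^^ n) p, (vertex_perm x ^^ n) q, (pair_twist x p q ^^ n) t) \<and>
    ((vertex_perm x ^^ n) p, (vertex_perm x ^^ n) q) \<in> Z \<and>
    pair_twist x ((vertex_perm x ^^ n) p) ((vertex_perm x ^^ n) q) = pair_twist x p q"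
  proof (induction n)
    case 0
    then show ?case using pq by simp
  next
    case (Suc n)
    have "vertex_perm x x = x" using vertex_perm_fixed[OF x] by blast
    moreover have "(vertex_perm x p', vertex_perm x q') \<in> Z \<longleftrightarrow> (p', q') \<in> Z" for p' q'
      using Z x by (simp add: invariant_nonedges_def)
    ultimately show ?case
      using Suc pair_twist_fixing[OF x] by (simp add: pair_move_def)
  qed
  then show ?thesis by simp
qed

lemma finite_perm_group_of_pair_moves:
  assumes fin: "finite (carrier (trickle_group V E \<mu> \<phi>))" and Z: "invariant_nonedges Z"
  obtains H where "finite H" "pair_move Z ` V \<subseteq> H" "\<And>f. f \<in> H \<Longrightarrow> bij f"
    "\<And>f g. f \<in> H \<Longrightarrow> g \<in> H \<Longrightarrow> f \<circ> g \<in> H" "\<And>f. f \<in> H \<Longrightarrow> inv_into UNIV f \<in> H"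
proof (rule finite_perm_group_of_action[OF fin, of "pair_move Z"])
  show "bij (pair_move Z x)" if "x \<in> V" for x using bij_pair_move[OF Z that] .
next
  fix x n assume x: "x \<in> V" "\<mu> x = enat n"
  show "pair_move Z x ^^ n = id"
  proof
    fix s :: "'a \<times> 'a \<times> complex"
    obtain p q t where s: "s = (p, q, t)" by (metis prod_cases3)
    show "(pair_move Z x ^^ n) s = id s"
    proof (cases "(p, q) \<in> Z")
      case True
      have "(pair_twist x p q ^^ n) t = t"
        using label_root_power[OF x(2)] by (auto simp: pair_twist_funpow)
      then show ?thesis
        using pair_move_funpow[OF Z x(1) True] vertex_perm_funpow[OF x] s by simp
    next
      case False
      have "(pair_move Z x ^^ k) s = s" for k
        by (induction k) (use False s in \<open>auto simp: pair_move_def\<close>)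
      then show ?thesis by simp
    qed
  qed
next
  fix x y assume xy: "x \<in> V" "y \<in> V" "y \<preceq> x" "y \<noteq> x"
  have y': "vertex_perm x y = \<phi> x y" using vertex_perm_below xy by simp
  have y'V: "\<phi> x y \<in> V" using vertex_perm_in_V_iff[of x y] xy y' by simp
  have fix_x: "vertex_perm y x = x"
    using vertex_perm_fixed[of y x] leq_antisym[of x y] xy by blast
  have e: "{y, x} \<in> E" using less_edge xy by blast
  show "pair_move Z (\<phi> x y) \<circ> pair_move Z x = pair_move Z x \<circ> pair_move Z y"
  proof
    fix s :: "'a \<times> 'a \<times> complex"
    obtain p q t where s: "s = (p, q, t)" by (metis prod_cases3)
    show "(pair_move Z (\<phi> x y) \<circ> pair_move Z x) s = (pair_move Z x \<circ> pair_move Z y) s"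
    proof (cases "(p, q) \<in> Z")
      case True
      then have V: "p \<in> V" "q \<in> V" "{p, q} \<notin> E" using Z by (auto simp: invariant_nonedges_def)
      have "(vertex_perm x p, vertex_perm x q) \<in> Z" "(vertex_perm y p, vertex_perm y q) \<in> Z"
        using True Z xy by (auto simp: invariant_nonedges_def)
      moreover have "pair_twist (\<phi> x y) (vertex_perm x p) (vertex_perm x q) = pair_twist y p q"
        using pair_twist_vertex_perm[OF xy(1), of y] y' by simp
      ultimately show ?thesis
        using s True pair_twist_fixing[OF xy(2) fix_x] pair_twist_commute[OF e V(3)]
          vertex_perm_down[OF xy V(1)] vertex_perm_down[OF xy V(2)]
        by (simp add: pair_move_def)
    qed (simp add: s pair_move_def)
  qed
next
  fix x y assume xy: "x \<in> V" "y \<in> V" "{x, y} \<in> E" "\<not> x \<preceq> y" "\<not> y \<preceq> x"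
  have fixed: "vertex_perm x y = y" "vertex_perm y x = x"
    using vertex_perm_fixed xy by auto
  show "pair_move Z x \<circ> pair_move Z y = pair_move Z y \<circ> pair_move Z x"
  proof
    fix s :: "'a \<times> 'a \<times> complex"
    obtain p q t where s: "s = (p, q, t)" by (metis prod_cases3)
    show "(pair_move Z x \<circ> pair_move Z y) s = (pair_move Z y \<circ> pair_move Z x) s"
    proof (cases "(p, q) \<in> Z")
      case True
      then have V: "p \<in> V" "q \<in> V" "{p, q} \<notin> E" using Z by (auto simp: invariant_nonedges_def)
      have "(vertex_perm x p, vertex_perm x q) \<in> Z" "(vertex_perm y p, vertex_perm y q) \<in> Z"
        using True Z xy by (auto simp: invariant_nonedges_def)
      then show ?thesis
        using s True pair_twist_fixing[OF xy(1) fixed(1)] pair_twist_fixing[OF xy(2) fixed(2)]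
          pair_twist_commute[OF xy(3) V(3)]
          vertex_perm_parallel[OF xy V(1)] vertex_perm_parallel[OF xy V(2)]
        by (simp add: pair_move_def)
    qed (simp add: s pair_move_def)
  qed
qed (use that in blast)

section \<open>Finiteness of the vertex set and of the labels\<close>

text \<open>
  Over the diagonal the action is the monomial one: each generator permutes the vertices and
  rescales one coordinate.
\<close>

lemma diagonal_invariant: "invariant_nonedges {(p, q). p \<in> V \<and> p = q}"
  using edge_neq[of x x for x]
  by (auto simp: invariant_nonedges_def vertex_perm_in_V_iff vertex_perm_eq_iff)

lemma finite_group_imp_finite_vertices:
  assumes fin: "finite (carrier (trickle_group V E \<mu> \<phi>))"
  shows "finite V" and "x \<in> V \<Longrightarrow> \<mu> x \<noteq> \<infinity>"
proof -
  let ?Z = "{(p, q). p \<in> V \<and> p = q}"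
  obtain H where H: "finite H" "pair_move ?Z ` V \<subseteq> H"
    "\<And>f g. f \<in> H \<Longrightarrow> g \<in> H \<Longrightarrow> f \<circ> g \<in> H"
    by (rule finite_perm_group_of_pair_moves[OF fin diagonal_invariant]) blast
  have "inj_on (pair_move ?Z) V"
  proof (rule inj_onI)
    fix x y assume *: "x \<in> V" "y \<in> V" "pair_move ?Z x = pair_move ?Z y"
    then have "pair_twist x x x 1 = pair_twist y x x 1"
      by (auto dest!: fun_cong[of _ _ "(x, x, 1)"] simp: pair_move_def)
    then show "x = y"
      using label_root_neq_1[OF *(1)] by (auto simp: pair_twist_def split: if_splits)
  qed
  then show "finite V" using H(1,2) finite_subset finite_imageD by blast
  assume x: "x \<in> V"
  show "\<mu> x \<noteq> \<infinity>"
  proof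
    assume "\<mu> x = \<infinity>"
    then have root: "label_root x = 2" by (simp add: label_root_def)
    obtain m n where mn: "m < n" "pair_move ?Z x ^^ m = pair_move ?Z x ^^ n"
      using funpow_repeats[OF H(1) _ H(3)] H(2) x by blast
    have "(pair_move ?Z x ^^ m) (x, x, 1) = (pair_move ?Z x ^^ n) (x, x, 1)" using mn(2) by simp
    then have "(2 :: complex) ^ m = 2 ^ n"
      using x root by (simp add: pair_move_funpow[OF diagonal_invariant x] pair_twist_funpow)
    then have "norm ((2 :: complex) ^ m) = norm ((2 :: complex) ^ n)" by simp
    then show False using mn(1) by (simp add: norm_power)
  qed
qed

section \<open>Completeness of the graph\<close>

definition dominating :: "'a set" where
  "dominating = {x\<in>V. \<forall>y\<in>V. y \<noteq> x \<longrightarrow> {x, y} \<in> E}"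

definition top_nondominating :: "'a set" where
  "top_nondominating = {m\<in>V - dominating. \<forall>y\<in>V - dominating. m \<preceq> y \<longrightarrow> y = m}"

definition top_nonedges :: "('a \<times> 'a) set" where
  "top_nonedges = {(p, q). p \<in> top_nondominating \<and> q \<in> top_nondominating \<and> {p, q} \<notin> E}"

lemma dominating_star: "x \<in> dominating \<Longrightarrow> star_verts V E x = V"
  by (auto simp: dominating_def star_verts_def)

lemma vertex_perm_edge_iff:
  assumes "x \<in> V" "y \<in> star_verts V E x" "z \<in> star_verts V E x"
  shows "{vertex_perm x y, vertex_perm x z} \<in> E \<longleftrightarrow> {y, z} \<in> E"
  using automorphism[OF assms(1)] assms bij_betw_apply[OF bij_betw_star[OF assms(1)]]
  unfolding graph_automorphism_def star_edges_def full_subgraph_edges_def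
  by (auto simp: vertex_perm_def)

lemma all_vertices_vertex_perm:
  assumes "x \<in> V"
  shows "(\<forall>y\<in>V. P (vertex_perm x y)) \<longleftrightarrow> (\<forall>y\<in>V. P y)"
  using bij_is_surj[OF bij_vertex_perm[OF assms]] vertex_perm_in_V_iff[OF assms]
  by (metis surjD)

text \<open>
  The star of a dominating vertex is all of \<open>V\<close>, so its permutation is an automorphism of the whole
  ordered graph and preserves every notion defined from edges and order.
\<close>

lemma dominating_preserved:
  assumes x: "x \<in> dominating"
  shows "vertex_perm x y \<in> dominating \<longleftrightarrow> y \<in> dominating"
proof -
  have xV: "x \<in> V" using x by (simp add: dominating_def)
  show ?thesis
    unfolding dominating_def mem_Collect_eq
    using all_vertices_vertex_perm[OF xV, of "\<lambda>z. z \<noteq> vertex_perm x y \<longrightarrow> {vertex_perm x y, z} \<in> E"]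
      vertex_perm_edge_iff[OF xV, of y] dominating_star[OF x] vertex_perm_in_V_iff[OF xV]
    by (auto simp: vertex_perm_eq_iff[OF xV])
qed

lemma top_nondominating_preserved:
  assumes x: "x \<in> dominating"
  shows "vertex_perm x y \<in> top_nondominating \<longleftrightarrow> y \<in> top_nondominating"
proof -
  have xV: "x \<in> V" using x by (simp add: dominating_def)
  have "y \<in> V \<Longrightarrow> (\<forall>z\<in>V. z \<notin> dominating \<longrightarrow> vertex_perm x y \<preceq> z \<longrightarrow> z = vertex_perm x y)
     \<longleftrightarrow> (\<forall>z\<in>V. z \<notin> dominating \<longrightarrow> y \<preceq> z \<longrightarrow> z = y)"
    using all_vertices_vertex_perm[OF xV,
        of "\<lambda>z. z \<notin> dominating \<longrightarrow> vertex_perm x y \<preceq> z \<longrightarrow> z = vertex_perm x y"]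
      vertex_perm_leq_iff[OF xV, of _ y] dominating_star[OF x] dominating_preserved[OF x]
    by (auto simp: vertex_perm_eq_iff[OF xV])
  then show ?thesis
    unfolding top_nondominating_def mem_Collect_eq
    using dominating_preserved[OF x, of y] vertex_perm_in_V_iff[OF xV, of y] by blast
qed

text \<open>
  A moved vertex lies strictly below the vertex that moves it, which maximality excludes.
\<close>

lemma top_nondominating_fixed:
  assumes "x \<in> V" "x \<notin> dominating" "m \<in> top_nondominating"
  shows "vertex_perm x m = m"
  using assms vertex_perm_fixed[of x m] by (auto simp: top_nondominating_def)

lemma top_nonedges_invariant: "invariant_nonedges top_nonedges"
  unfolding invariant_nonedges_def
proof (intro conjI ballI allI)
  show "top_nonedges \<subseteq> V \<times> V" by (auto simp: top_nonedges_def top_nondominating_def)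
  show "case e of (p, q) \<Rightarrow> {p, q} \<notin> E" if "e \<in> top_nonedges" for e
    using that by (auto simp: top_nonedges_def)
next
  fix x p q assume x: "x \<in> V"
  show "(vertex_perm x p, vertex_perm x q) \<in> top_nonedges \<longleftrightarrow> (p, q) \<in> top_nonedges"
  proof (cases "x \<in> dominating")
    case True
    have "p \<in> V \<Longrightarrow> q \<in> V \<Longrightarrow> {vertex_perm x p, vertex_perm x q} \<in> E \<longleftrightarrow> {p, q} \<in> E"
      using vertex_perm_edge_iff[OF x] dominating_star[OF True] by simp
    then show ?thesis
      using top_nondominating_preserved[OF True]
      by (auto simp: top_nonedges_def top_nondominating_def)
  next
    case False
    have "vertex_perm x p \<in> top_nondominating \<Longrightarrow> vertex_perm x p = p" for p
      using top_nondominating_fixed[OF x False] vertex_perm_eq_iff[OF x] by metis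
    then show ?thesis using top_nondominating_fixed[OF x False]
      by (auto simp: top_nonedges_def) metis+
  qed
qed

lemma top_nondominating_above:
  assumes fin: "finite V" and x: "x \<in> V" "x \<notin> dominating"
  obtains m where "m \<in> top_nondominating" "x \<preceq> m"
proof -
  let ?A = "{y\<in>V - dominating. x \<preceq> y}"
  let ?R = "\<lambda>y z. y \<in> V \<and> z \<in> V \<and> y \<preceq> z \<and> y \<noteq> z"
  have "finite ?A" "x \<in> ?A" using fin x leq_refl by auto
  moreover have "transp_on ?A ?R" "asymp_on ?A ?R"
    unfolding transp_on_def asymp_on_def using leq_trans leq_antisym by blast+
  ultimately obtain m where m: "m \<in> ?A" "\<forall>y\<in>?A. \<not> ?R m y"
    using Finite_Set.bex_max_element[of ?A ?R] by (metis (no_types, lifting) empty_iff)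
  have "y = m" if "y \<in> V - dominating" "m \<preceq> y" for y
    using m that leq_trans[of x m y] x by blast
  then show thesis using that[of m] m(1) by (auto simp: top_nondominating_def)
qed

text \<open>
  Take a maximal non-dominating \<open>a\<close>, some \<open>y\<close> not adjacent to it, and a maximal non-dominating \<open>b\<close>
  above \<open>y\<close>. They differ, because everything below \<open>a\<close> is adjacent to it. So maximality makes
  them incomparable, and an edge between them would go down to an edge from \<open>a\<close> to \<open>y\<close>.
\<close>

lemma exists_top_nonedge:
  assumes fin: "finite V" and nc: "\<not> complete_graph V E"
  obtains a b where "(a, b) \<in> top_nonedges" "a \<noteq> b"
proof -
  obtain x y where "x \<in> V" "y \<in> V" "x \<noteq> y" "{x, y} \<notin> E"
    using nc by (auto simp: complete_graph_def)
  then have "x \<notin> dominating" by (auto simp: dominating_def)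
  then obtain a where a: "a \<in> top_nondominating"
    using top_nondominating_above[OF fin \<open>x \<in> V\<close>] by blast
  then have aV: "a \<in> V" by (simp add: top_nondominating_def)
  from a obtain y where y: "y \<in> V" "y \<noteq> a" "{a, y} \<notin> E"
    by (auto simp: top_nondominating_def dominating_def)
  then have "y \<notin> dominating" using aV by (auto simp: dominating_def insert_commute)
  then obtain b where b: "b \<in> top_nondominating" "y \<preceq> b"
    using top_nondominating_above[OF fin y(1)] by blast
  then have bV: "b \<in> V" by (simp add: top_nondominating_def)
  have "a \<noteq> b" using b(2) y less_edge[of y a] aV by (auto simp: insert_commute)
  moreover have "{a, b} \<notin> E"
  proof
    assume ab: "{a, b} \<in> E"
    have "\<not> a \<preceq> b" "\<not> b \<preceq> a"
      using a b(1) \<open>a \<noteq> b\<close> by (auto simp: top_nondominating_def)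
    then show False using parallel_down[of a b y] aV bV y ab b(2) by blast
  qed
  ultimately show thesis using that[of a b] a b by (simp add: top_nonedges_def)
qed

lemma finite_group_imp_complete:
  assumes fin: "finite (carrier (trickle_group V E \<mu> \<phi>))"
  shows "complete_graph V E"
proof (rule ccontr)
  assume "\<not> complete_graph V E"
  then obtain a b where ab: "(a, b) \<in> top_nonedges" "a \<noteq> b"
    using exists_top_nonedge finite_group_imp_finite_vertices(1)[OF fin] by metis
  let ?T = "pair_move top_nonedges"
  obtain H where H: "finite H" "?T ` V \<subseteq> H" "\<And>f. f \<in> H \<Longrightarrow> bij f"
    "\<And>f g. f \<in> H \<Longrightarrow> g \<in> H \<Longrightarrow> f \<circ> g \<in> H" "\<And>f. f \<in> H \<Longrightarrow> inv_into UNIV f \<in> H"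
    by (rule finite_perm_group_of_pair_moves[OF fin top_nonedges_invariant]) blast
  have V: "a \<in> V" "b \<in> V" "a \<notin> dominating" "b \<notin> dominating"
    "a \<in> top_nondominating" "b \<in> top_nondominating"
    using ab by (auto simp: top_nonedges_def top_nondominating_def)
  have Ta: "?T a (a, b, t) = (a, b, label_root a * t)" for t
    using top_nondominating_fixed[OF V(1,3)] V ab by (simp add: pair_move_def pair_twist_def)
  have Tb: "?T b (a, b, t) = (a, b, label_root b * (t - 1) + 1)" for t
    using top_nondominating_fixed[OF V(2,4)] V ab by (simp add: pair_move_def pair_twist_def)
  \<comment> \<open>The commutator \<open>h\<close> of the rotations is written as \<open>f g\<^sup>-\<^sup>1\<close>, where \<open>f\<close> and \<open>g\<close> are the two products:
    these have the same linear part and differ by the constant \<open>c\<close>.\<close>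
  define f where "f = ?T a \<circ> ?T b"
  define g where "g = ?T b \<circ> ?T a"
  define c where "c = (label_root a - 1) * (1 - label_root b)"
  define h where "h = f \<circ> inv_into UNIV g"
  have c: "c \<noteq> 0" using label_root_neq_1 V by (simp add: c_def)
  have fg: "f \<in> H" "g \<in> H" "h \<in> H" using H(2) V unfolding h_def f_def g_def by (blast intro: H(4,5))+
  have g_val: "g (a, b, t) = (a, b, label_root b * (label_root a * t - 1) + 1)" for t
    by (simp add: g_def Ta Tb)
  have f_val: "f (a, b, t) = (a, b, label_root b * (label_root a * t - 1) + 1 + c)" for t
    by (simp add: f_def Ta Tb c_def algebra_simps)
  have h_val: "h (a, b, t) = (a, b, t + c)" for t
  proof -
    define s where "s = ((t - 1) / label_root b + 1) / label_root a"
    have "g (a, b, s) = (a, b, t)" by (simp add: g_val s_def label_root_nonzero)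
    then have "inv_into UNIV g (a, b, t) = (a, b, s)"
      using inv_f_f[OF bij_is_inj[OF H(3)[OF fg(2)]]] by metis
    then show ?thesis by (simp add: h_def f_val s_def label_root_nonzero)
  qed
  have "(h ^^ n) (a, b, 0) = (a, b, of_nat n * c)" for n
    by (induction n) (simp_all add: h_val algebra_simps)
  moreover obtain m n where "m < n" "h ^^ m = h ^^ n"
    using funpow_repeats[OF H(1) fg(3) H(4)] by blast
  ultimately show False using c by (metis Pair_inject mult_cancel_right nat_neq_iff of_nat_eq_iff)
qed

section \<open>Finiteness of complete trickle groups\<close>

definition trickle_gen :: "'a \<Rightarrow> 'a gword set" where
  "trickle_gen x = pres_rel V (trickle_relations V E \<mu> \<phi>) `` {[(x, True)]}"

sublocale trickle: group "trickle_group V E \<mu> \<phi>"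
  unfolding trickle_group_def by (rule group_presented_group)

lemma trickle_gen_closed: "x \<in> V \<Longrightarrow> trickle_gen x \<in> carrier (trickle_group V E \<mu> \<phi>)"
  unfolding trickle_gen_def trickle_group_def by (intro pres_class_in_carrier) simp

lemma trickle_gen_power:
  assumes "x \<in> V" "\<mu> x = enat n"
  shows "trickle_gen x [^]\<^bsub>trickle_group V E \<mu> \<phi>\<^esub> n = \<one>\<^bsub>trickle_group V E \<mu> \<phi>\<^esub>"
proof -
  let ?R = "trickle_relations V E \<mu> \<phi>"
  have word: "replicate k (x, True) \<in> gwords V" for k
    using assms(1) by (induction k) auto
  have "trickle_gen x [^]\<^bsub>trickle_group V E \<mu> \<phi>\<^esub> k = pres_rel V ?R `` {replicate k (x, True)}" for k
  proof (induction k)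
    case 0
    then show ?case by (simp add: trickle_group_def one_presented_group)
  next
    case (Suc k)
    then show ?case
      using mult_presented_group[of "replicate k (x, True)" V "[(x, True)]" ?R] word[of k] assms(1)
      by (simp add: trickle_group_def trickle_gen_def replicate_append_same)
  qed
  moreover have "(replicate n (x, True), []) \<in> ?R"
    using assms by (auto simp: trickle_relations_def)
  ultimately show ?thesis
    using word[of n] 
    by (simp add: trickle_group_def one_presented_group pres_class_eq_iff pres_eq.relation)
qed

lemma trickle_gen_edge:
  assumes "x \<in> V" "y \<in> V" "{x, y} \<in> E"
  shows "trickle_gen (\<phi> x y) \<otimes>\<^bsub>trickle_group V E \<mu> \<phi>\<^esub> trickle_gen x =
    trickle_gen (\<phi> y x) \<otimes>\<^bsub>trickle_group V E \<mu> \<phi>\<^esub> trickle_gen y"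
proof -
  have "([(\<phi> x y, True), (x, True)], [(\<phi> y x, True), (y, True)]) \<in> trickle_relations V E \<mu> \<phi>"
    using assms by (auto simp: trickle_relations_def)
  moreover have "\<phi> x y \<in> V" "\<phi> y x \<in> V"
    using assms phi_adjacent_in_verts by (auto simp: insert_commute)
  ultimately show ?thesis
    using assms
    by (simp add: trickle_group_def trickle_gen_def mult_presented_group pres_class_eq_iff
        pres_eq.relation)
qed

text \<open>
  The relation reads \<open>\<phi> x z \<cdot> x = x \<cdot> z\<close> when \<open>z\<close> is not above \<open>x\<close>; apply it to the preimage \<open>z\<close> of \<open>y\<close>.
\<close>

lemma trickle_gen_pass:
  assumes "x \<in> V" "y \<in> V" "{x, y} \<in> E" "\<not> x \<preceq> y"
  obtains z where "z \<in> V" "z = y \<or> z \<preceq> x \<and> z \<noteq> x"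
    "trickle_gen y \<otimes>\<^bsub>trickle_group V E \<mu> \<phi>\<^esub> trickle_gen x =
     trickle_gen x \<otimes>\<^bsub>trickle_group V E \<mu> \<phi>\<^esub> trickle_gen z"
proof -
  have "y \<in> \<phi> x ` star_verts V E x"
    unfolding bij_betw_imp_surj_on[OF bij_betw_star[OF assms(1)]]
    using assms(2,3) by (simp add: star_verts_def)
  then obtain z where z: "z \<in> star_verts V E x" "\<phi> x z = y" by blast
  have zV: "z \<in> V" using z(1) star_subset assms(1) by blast
  have zy: "z = y \<or> z \<preceq> x \<and> z \<noteq> x" using moved_less[OF assms(1) z(1)] unfolding z(2) by blast
  have "z \<noteq> x" using z(2) phi_self[OF assms(1)] edge_neq[OF assms(3)] by metis
  then have e: "{x, z} \<in> E" using z(1) by (auto simp: star_verts_def)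
  have "\<not> x \<preceq> z" using zy assms(1,4) leq_antisym[of x z] zV by auto
  then have "\<phi> z x = x"
    using moved_less[OF zV, of x] e assms(1) by (auto simp: star_verts_def insert_commute)
  then have "trickle_gen y \<otimes>\<^bsub>trickle_group V E \<mu> \<phi>\<^esub> trickle_gen x =
     trickle_gen x \<otimes>\<^bsub>trickle_group V E \<mu> \<phi>\<^esub> trickle_gen z"
    using trickle_gen_edge[OF assms(1) zV e] z(2) by simp
  then show thesis using that zV zy by blast
qed

text \<open>
  Remove a maximal vertex \<open>x\<close> from \<open>U\<close> and let \<open>A\<close> be the finite set for the rest. The products \<open>x\<^sup>i a\<close>
  with \<open>a \<in> A\<close> and \<open>i < \<mu> x\<close> form the set for \<open>U\<close>: a generator other than \<open>x\<close> passes through \<open>x\<^sup>i\<close> and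
  arrives at \<open>a\<close> as another generator of \<open>U - {x}\<close>, since \<open>U\<close> is down-closed.
\<close>

lemma down_set_finite_closed:
  assumes complete: "complete_graph V E" and label: "\<forall>x\<in>V. \<mu> x \<noteq> \<infinity>"
  shows "\<lbrakk>finite U; U \<subseteq> V; \<And>x y. \<lbrakk>x \<in> U; y \<in> V; y \<preceq> x\<rbrakk> \<Longrightarrow> y \<in> U\<rbrakk> \<Longrightarrow>
    \<exists>A\<subseteq>carrier (trickle_group V E \<mu> \<phi>). finite A \<and> \<one>\<^bsub>trickle_group V E \<mu> \<phi>\<^esub> \<in> A \<and>
      (\<forall>x\<in>U. \<forall>a\<in>A. trickle_gen x \<otimes>\<^bsub>trickle_group V E \<mu> \<phi>\<^esub> a \<in> A)"
proof (induction U rule: finite_psubset_induct)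
  case (psubset U)
  let ?G = "trickle_group V E \<mu> \<phi>"
  show ?case
  proof (cases "U = {}")
    case True
    then show ?thesis by (intro exI[of _ "{\<one>\<^bsub>?G\<^esub>}"]) auto
  next
    case False
    let ?R = "\<lambda>y z. y \<in> V \<and> z \<in> V \<and> y \<preceq> z \<and> y \<noteq> z"
    have "transp_on U ?R" "asymp_on U ?R"
      unfolding transp_on_def asymp_on_def using leq_trans leq_antisym by blast+
    then obtain x where x: "x \<in> U" "\<forall>y\<in>U. \<not> ?R x y"
      using Finite_Set.bex_max_element[of U ?R] psubset.hyps False by metis
    have xV: "x \<in> V" using x(1) psubset.prems(1) by blast
    obtain n where n: "\<mu> x = enat n" using label xV by auto
    have pos: "0 < n" using label_ge_2[OF xV] n by (cases n) (auto simp: zero_enat_def[symmetric])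
    let ?U = "U - {x}"
    have "?U \<subset> U" "?U \<subseteq> V" using x(1) psubset.prems(1) by auto
    moreover have "y \<in> ?U" if "u \<in> ?U" "y \<in> V" "y \<preceq> u" for u y
      using psubset.prems that x xV by blast
    ultimately obtain A where A: "A \<subseteq> carrier ?G" "finite A" "\<one>\<^bsub>?G\<^esub> \<in> A"
      "\<And>y a. y \<in> ?U \<Longrightarrow> a \<in> A \<Longrightarrow> trickle_gen y \<otimes>\<^bsub>?G\<^esub> a \<in> A"
      using psubset.IH[of ?U] by metis
    note gx = trickle_gen_closed[OF xV]
    have pass: "\<exists>z\<in>?U. trickle_gen y \<otimes>\<^bsub>?G\<^esub> trickle_gen x = trickle_gen x \<otimes>\<^bsub>?G\<^esub> trickle_gen z"
      if y: "y \<in> ?U" for y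
    proof -
      have yV: "y \<in> V" using y psubset.prems(1) by blast
      have "{x, y} \<in> E" using complete xV yV y by (auto simp: complete_graph_def)
      moreover have "\<not> x \<preceq> y" using x(2) xV yV y by blast
      ultimately obtain z where "z \<in> V" "z = y \<or> z \<preceq> x \<and> z \<noteq> x"
        "trickle_gen y \<otimes>\<^bsub>?G\<^esub> trickle_gen x = trickle_gen x \<otimes>\<^bsub>?G\<^esub> trickle_gen z"
        using trickle_gen_pass[OF xV yV] by metis
      then show ?thesis using y psubset.prems(2)[OF x(1), of z] by blast
    qed
    have gen_U: "trickle_gen y \<in> carrier ?G" if "y \<in> ?U" for y
      using that psubset.prems(1) by (intro trickle_gen_closed) blast
    have pass_power: "\<exists>z\<in>?U. trickle_gen y \<otimes>\<^bsub>?G\<^esub> trickle_gen x [^]\<^bsub>?G\<^esub> i =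
        trickle_gen x [^]\<^bsub>?G\<^esub> i \<otimes>\<^bsub>?G\<^esub> trickle_gen z" if y: "y \<in> ?U" for y and i :: nat
    proof (induction i)
      case 0
      then show ?case using y gen_U[OF y] by (intro bexI[of _ y]) simp_all
    next
      case (Suc i)
      then obtain z where z: "z \<in> ?U" "trickle_gen y \<otimes>\<^bsub>?G\<^esub> trickle_gen x [^]\<^bsub>?G\<^esub> i =
        trickle_gen x [^]\<^bsub>?G\<^esub> i \<otimes>\<^bsub>?G\<^esub> trickle_gen z" by blast
      obtain w where w: "w \<in> ?U"
        "trickle_gen z \<otimes>\<^bsub>?G\<^esub> trickle_gen x = trickle_gen x \<otimes>\<^bsub>?G\<^esub> trickle_gen w"
        using pass[OF z(1)] by blast
      have "trickle_gen y \<otimes>\<^bsub>?G\<^esub> trickle_gen x [^]\<^bsub>?G\<^esub> Suc i =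
          (trickle_gen y \<otimes>\<^bsub>?G\<^esub> trickle_gen x [^]\<^bsub>?G\<^esub> i) \<otimes>\<^bsub>?G\<^esub> trickle_gen x"
        using gen_U[OF y] gx by (simp add: trickle.m_assoc)
      also have "\<dots> = trickle_gen x [^]\<^bsub>?G\<^esub> i \<otimes>\<^bsub>?G\<^esub> (trickle_gen z \<otimes>\<^bsub>?G\<^esub> trickle_gen x)"
        using gen_U[OF z(1)] gx z(2) by (simp add: trickle.m_assoc)
      also have "\<dots> = trickle_gen x [^]\<^bsub>?G\<^esub> Suc i \<otimes>\<^bsub>?G\<^esub> trickle_gen w"
        using gen_U[OF w(1)] gx w(2) by (simp add: trickle.m_assoc)
      finally show ?case using w(1) by blast
    qed
    define B where "B = (\<lambda>(i, a). trickle_gen x [^]\<^bsub>?G\<^esub> i \<otimes>\<^bsub>?G\<^esub> a) ` ({..<n} \<times> A)"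
    have memB: "trickle_gen x [^]\<^bsub>?G\<^esub> i \<otimes>\<^bsub>?G\<^esub> a \<in> B" if "i \<le> n" "a \<in> A" for i a
    proof (cases "i = n")
      case True
      then have "trickle_gen x [^]\<^bsub>?G\<^esub> i = trickle_gen x [^]\<^bsub>?G\<^esub> (0::nat)"
        using trickle_gen_power[OF xV n] by simp
      then show ?thesis using pos that unfolding B_def
        by (intro image_eqI[of _ _ "(0, a)"]) auto
    next
      case False
      then show ?thesis using that unfolding B_def by (intro image_eqI[of _ _ "(i, a)"]) auto
    qed
    have "B \<subseteq> carrier ?G" using A(1) gx by (auto simp: B_def)
    moreover have "finite B" using A(2) by (simp add: B_def)
    moreover have "\<one>\<^bsub>?G\<^esub> \<in> B" using memB[of 0, OF _ A(3)] by simp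
    moreover have "trickle_gen y \<otimes>\<^bsub>?G\<^esub> b \<in> B" if yb: "y \<in> U" "b \<in> B" for y b
    proof -
      obtain i a where ia: "i < n" "a \<in> A" "b = trickle_gen x [^]\<^bsub>?G\<^esub> i \<otimes>\<^bsub>?G\<^esub> a"
        using yb(2) by (auto simp: B_def)
      have aG: "a \<in> carrier ?G" using A(1) ia(2) by blast
      show ?thesis
      proof (cases "y = x")
        case True
        have "trickle_gen y \<otimes>\<^bsub>?G\<^esub> b = trickle_gen x [^]\<^bsub>?G\<^esub> Suc i \<otimes>\<^bsub>?G\<^esub> a"
          using True ia(3) gx aG trickle.nat_pow_Suc2[OF gx, of i]
          by (simp add: trickle.m_assoc del: trickle.nat_pow_Suc)
        then show ?thesis using memB[of "Suc i" a] ia by simp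
      next
        case False
        then have y: "y \<in> ?U" using yb(1) by blast
        obtain z where z: "z \<in> ?U" "trickle_gen y \<otimes>\<^bsub>?G\<^esub> trickle_gen x [^]\<^bsub>?G\<^esub> i =
          trickle_gen x [^]\<^bsub>?G\<^esub> i \<otimes>\<^bsub>?G\<^esub> trickle_gen z" using pass_power[OF y] by blast
        have "trickle_gen y \<otimes>\<^bsub>?G\<^esub> b =
            (trickle_gen y \<otimes>\<^bsub>?G\<^esub> trickle_gen x [^]\<^bsub>?G\<^esub> i) \<otimes>\<^bsub>?G\<^esub> a"
          using ia(3) gx aG gen_U[OF y] by (simp add: trickle.m_assoc)
        also have "\<dots> = trickle_gen x [^]\<^bsub>?G\<^esub> i \<otimes>\<^bsub>?G\<^esub> (trickle_gen z \<otimes>\<^bsub>?G\<^esub> a)"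
          using z gx aG gen_U[OF z(1)] by (simp add: trickle.m_assoc)
        finally show ?thesis using memB[of i] ia A(4)[OF z(1) ia(2)] by simp
      qed
    qed
    ultimately show ?thesis by blast
  qed
qed

lemma complete_imp_finite_group:
  assumes fin: "finite V" and complete: "complete_graph V E" and label: "\<forall>x\<in>V. \<mu> x \<noteq> \<infinity>"
  shows "finite (carrier (trickle_group V E \<mu> \<phi>))"
proof -
  let ?G = "trickle_group V E \<mu> \<phi>"
  let ?R = "trickle_relations V E \<mu> \<phi>"
  obtain A where A: "finite A" "A \<subseteq> carrier ?G" "\<one>\<^bsub>?G\<^esub> \<in> A"
    "\<And>x a. x \<in> V \<Longrightarrow> a \<in> A \<Longrightarrow> trickle_gen x \<otimes>\<^bsub>?G\<^esub> a \<in> A"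
    using down_set_finite_closed[OF complete label fin order_refl] by auto
  have power: "trickle_gen x [^]\<^bsub>?G\<^esub> (k::nat) \<otimes>\<^bsub>?G\<^esub> a \<in> A" if "x \<in> V" "a \<in> A" for x a k
  proof (induction k)
    case 0
    then show ?case using that A(2) by auto
  next
    case (Suc k)
    have "a \<in> carrier ?G" using that A(2) by blast
    then have "trickle_gen x [^]\<^bsub>?G\<^esub> Suc k \<otimes>\<^bsub>?G\<^esub> a =
        trickle_gen x \<otimes>\<^bsub>?G\<^esub> (trickle_gen x [^]\<^bsub>?G\<^esub> k \<otimes>\<^bsub>?G\<^esub> a)"
      using trickle.nat_pow_Suc2[OF trickle_gen_closed[OF that(1)], of k]
        trickle_gen_closed[OF that(1)]
      by (simp add: trickle.m_assoc del: trickle.nat_pow_Suc)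
    then show ?case using A(4) that(1) Suc by simp
  qed
  \<comment> \<open>Finite labels make inverse letters powers of generators, so closure under generators is enough.\<close>
  have inverse: "pres_rel V ?R `` {[(x, False)]} = trickle_gen x [^]\<^bsub>?G\<^esub> (n - 1)"
    if x: "x \<in> V" and n: "\<mu> x = enat n" for x n
  proof -
    have gx: "trickle_gen x \<in> carrier ?G" using trickle_gen_closed x .
    have cG: "pres_rel V ?R `` {[(x, False)]} \<in> carrier ?G"
      unfolding trickle_group_def using x by (intro pres_class_in_carrier) simp
    have "pres_rel V ?R `` {[(x, False)]} \<otimes>\<^bsub>?G\<^esub> trickle_gen x = \<one>\<^bsub>?G\<^esub>"
      using pres_eq.cancel[OF x, of ?R False] x
      by (simp add: trickle_group_def trickle_gen_def mult_presented_group one_presented_group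
          pres_class_eq_iff)
    moreover have "0 < n" using label_ge_2[OF x] n by (cases n) (auto simp: zero_enat_def[symmetric])
    then have "trickle_gen x [^]\<^bsub>?G\<^esub> (n - 1) \<otimes>\<^bsub>?G\<^esub> trickle_gen x = \<one>\<^bsub>?G\<^esub>"
      using trickle_gen_power[OF x n] trickle.nat_pow_Suc[of "trickle_gen x" "n - 1"] by simp
    ultimately show ?thesis
      using gx cG by (metis trickle.nat_pow_closed trickle.inv_equality)
  qed
  have "pres_rel V ?R `` {u} \<in> A" if "u \<in> gwords V" for u
    using that
  proof (induction u)
    case Nil
    then show ?case using A(3) by (simp add: trickle_group_def one_presented_group)
  next
    case (Cons l u)
    obtain x b where l: "l = (x, b)" by force
    then have x: "x \<in> V" and u: "u \<in> gwords V" using Cons.prems by auto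
    then have uA: "pres_rel V ?R `` {u} \<in> A" using Cons.IH by blast
    have split: "pres_rel V ?R `` {l # u} =
        pres_rel V ?R `` {[(x, b)]} \<otimes>\<^bsub>?G\<^esub> pres_rel V ?R `` {u}"
      using x u l by (simp add: trickle_group_def mult_presented_group)
    obtain n where n: "\<mu> x = enat n" using label x by auto
    show ?case
      using split A(4)[OF x uA] power[OF x uA] inverse[OF x n]
      by (cases b) (simp_all add: trickle_gen_def)
  qed
  then have "carrier ?G \<subseteq> A"
    by (auto simp: trickle_group_def carrier_presented_group)
  then show ?thesis using A(1) finite_subset by blast
qed

end

theorem corollary2p7:
  fixes V :: "'a set"
    and E :: "'a set set"
    and leq :: "'a \<Rightarrow> 'a \<Rightarrow> bool"
    and \<mu> :: "'a \<Rightarrow> enat"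
    and \<phi> :: "'a \<Rightarrow> 'a \<Rightarrow> 'a"
  assumes "trickle_graph V E leq \<mu> \<phi>"
  shows "finite (carrier (trickle_group V E \<mu> \<phi>)) \<longleftrightarrow>
    finite V \<and> complete_graph V E \<and> (\<forall>x\<in>V. \<mu> x \<noteq> \<infinity>)"
proof -
  interpret trickle_graph V E leq \<mu> \<phi> by (rule assms)
  show ?thesis
    using finite_group_imp_finite_vertices finite_group_imp_complete complete_imp_finite_group
    by blast
qed

end
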